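(* Let $a_1,a_2,a_3,b_1,b_2,b_3$ be any real numbers. Then $$ \begin{aligned} (a_1^2+b_2^2+b_3^2)&(a_2^2+b_3^2+b_1^2)(a_3^2+b_1^2+b_2^2) \\ \ge\ & (a_1b_1+a_2b_2+a_3b_3)^2\,(b_1^2+b_2^2+b_3^2) \\ &+\tfrac12\Big[b_1^2(a_2b_3-a_3b_2)^2+b_2^2(a_3b_1-a_1b_3)^2+b_3^2(a_1b_2-a_2b_1)^2\Big]. \end{aligned} $$ *)

theory Defs
  imports Complex_Main
begin

end

theory Submission
  imports Defs
begin

text \<open>
  The idea is to measure how far the products \<open>a\<^sub>ia\<^sub>j\<close> are from \<open>b\<^sub>ib\<^sub>j\<close>.  Put
  \<open>d\<^sub>k = a\<^sub>ia\<^sub>j - b\<^sub>ib\<^sub>j\<close> for \<open>{i, j, k} = {1, 2, 3}\<close>.  The terms of the two sides that are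
  quadratic in the \<open>a\<^sub>i\<close> have the same coefficients at \<open>a\<^sub>i\<^sup>2\<close>, so the difference of the sides
  depends on the \<open>a\<^sub>i\<close> only through the products \<open>a\<^sub>ia\<^sub>j\<close> (note that
  \<open>(a\<^sub>1a\<^sub>2a\<^sub>3)\<^sup>2\<close> is the product of all three).  Expanded in the \<open>d\<^sub>k\<close>, its
  constant and linear parts vanish, and what is left is a quadratic form plus \<open>d\<^sub>1d\<^sub>2d\<^sub>3\<close>
  (\<open>gap_eq_cubic\<close>).

  The quadratic form is positive semidefinite, with room to spare; only the cubic term can be
  harmful.  It can be merged with one mixed term of the form, since
  \<open>b\<^sub>ib\<^sub>jd\<^sub>id\<^sub>j + d\<^sub>1d\<^sub>2d\<^sub>3 = d\<^sub>id\<^sub>j \<sqdot> a\<^sub>ia\<^sub>j\<close>, and the rest of the form is still nonnegative.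
  So it suffices that one of the three numbers \<open>d\<^sub>id\<^sub>ja\<^sub>ia\<^sub>j\<close> is nonnegative
  (\<open>cubic_nonneg\<close>).  They cannot all be negative, because their product is the square
  \<open>(d\<^sub>1d\<^sub>2d\<^sub>3a\<^sub>1a\<^sub>2a\<^sub>3)\<^sup>2\<close>.
\<close>

lemma gap_eq_cubic:
  fixes a1 a2 a3 b1 b2 b3 d1 d2 d3 :: real
  assumes "d1 = a2*a3 - b2*b3" "d2 = a3*a1 - b3*b1" "d3 = a1*a2 - b1*b2"
  shows "(a1^2 + b2^2 + b3^2) * (a2^2 + b3^2 + b1^2) * (a3^2 + b1^2 + b2^2)
      - ((a1*b1 + a2*b2 + a3*b3)^2 * (b1^2 + b2^2 + b3^2)
         + 1/2 * (b1^2 * (a2*b3 - a3*b2)^2 + b2^2 * (a3*b1 - a1*b3)^2 + b3^2 * (a1*b2 - a2*b1)^2))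
    = b1^2 * (d2^2 + d3^2) + b2^2 * (d3^2 + d1^2) + b3^2 * (d1^2 + d2^2)
      + b1*b2*d1*d2 + b2*b3*d2*d3 + b3*b1*d3*d1 + d1*d2*d3"
  unfolding assms by (simp add: field_simps power2_eq_square)

text \<open>
  Each of the two mixed terms that are not merged with the cubic term is absorbed by half of two
  of the squares, as in \<open>(b\<^sub>2d\<^sub>3 + b\<^sub>3d\<^sub>2)\<^sup>2 \<ge> 0\<close>.  The hypothesis singles out the
  index 3; the other two choices follow because the expression is invariant under cyclic shifts.
\<close>

lemma cubic_nonneg:
  fixes b1 b2 b3 d1 d2 d3 :: real
  assumes "d1*d2*(b1*b2 + d3) \<ge> 0"
  shows "b1^2 * (d2^2 + d3^2) + b2^2 * (d3^2 + d1^2) + b3^2 * (d1^2 + d2^2)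
      + b1*b2*d1*d2 + b2*b3*d2*d3 + b3*b1*d3*d1 + d1*d2*d3 \<ge> 0"
    (is "?F \<ge> 0")
proof -
  have "?F = d1*d2*(b1*b2 + d3) + (b2*d3 + b3*d2)^2 / 2 + (b3*d1 + b1*d3)^2 / 2
      + (b1*d2)^2 + (b2*d1)^2
      + ((b1*d3)^2 + (b2*d3)^2 + (b3*d1)^2 + (b3*d2)^2) / 2"
    by (simp add: field_simps power2_eq_square)
  then show ?thesis
    using assms by simp
qed

theorem proposition1:
  fixes a1 a2 a3 b1 b2 b3 :: real
  shows "(a1^2 + b2^2 + b3^2) * (a2^2 + b3^2 + b1^2) * (a3^2 + b1^2 + b2^2)
    \<ge> (a1*b1 + a2*b2 + a3*b3)^2 * (b1^2 + b2^2 + b3^2)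
      + 1/2 * (b1^2 * (a2*b3 - a3*b2)^2 + b2^2 * (a3*b1 - a1*b3)^2 + b3^2 * (a1*b2 - a2*b1)^2)"
proof -
  define d1 where "d1 = a2*a3 - b2*b3"
  define d2 where "d2 = a3*a1 - b3*b1"
  define d3 where "d3 = a1*a2 - b1*b2"
  define g1 where "g1 = d2*d3*(b2*b3 + d1)"
  define g2 where "g2 = d3*d1*(b3*b1 + d2)"
  define g3 where "g3 = d1*d2*(b1*b2 + d3)"
  have "b2*b3 + d1 = a2*a3" "b3*b1 + d2 = a3*a1" "b1*b2 + d3 = a1*a2"
    by (simp_all add: d1_def d2_def d3_def)
  then have "g1*g2*g3 = (d1*d2*d3*(a1*a2*a3))^2"
    by (simp add: g1_def g2_def g3_def power2_eq_square)
  then have "g1*g2*g3 \<ge> 0"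
    by simp
  then have "g1 \<ge> 0 \<or> g2 \<ge> 0 \<or> g3 \<ge> 0"
    by (smt (verit) mult_neg_neg mult_pos_neg)
  then have "b1^2 * (d2^2 + d3^2) + b2^2 * (d3^2 + d1^2) + b3^2 * (d1^2 + d2^2)
      + b1*b2*d1*d2 + b2*b3*d2*d3 + b3*b1*d3*d1 + d1*d2*d3 \<ge> 0"
    using cubic_nonneg[of d2 d3 b2 b3 d1 b1] cubic_nonneg[of d3 d1 b3 b1 d2 b2]
      cubic_nonneg[of d1 d2 b1 b2 d3 b3]
    unfolding g1_def g2_def g3_def by (auto simp: algebra_simps)
  then show ?thesis
    using gap_eq_cubic[OF d1_def d2_def d3_def] by linarith
qed

end
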